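(* There exists a finitely generated commutative $\mathbb{C}$-algebra $A$ of (Krull) dimension $3$ such that the Derksen invariant of $A$ is not finitely generated as a $\mathbb{C}$-algebra and the Makar-Limanov invariant of $A$ is not finitely generated as a $\mathbb{C}$-algebra; moreover, for this $A$ the Derksen invariant is equal to the Makar-Limanov invariant.
   Context: Let $A$ be a commutative $\mathbb{C}$-algebra. A derivation of $A$ is a $\mathbb{C}$-linear map $D: A\to A$ satisfying $D(ab)=aD(b)+bD(a)$ for all $a,b\in A$. It is locally nilpotent if for each $a\in A$ there is some $n\in\mathbb{N}$ with $D^n(a)=0$. The kernel of $D$ is $A^D=\{a\in A : D(a)=0\}$, a $\mathbb{C}$-subalgebra of $A$. The Makar-Limanov invariant of $A$ is the intersection of the kernels $A^D$ of all locally nilpotent derivations $D$ of $A$. The Derksen invariant of $A$ is the smallest $\mathbb{C}$-subalgebra of $A$ containing the kernels $A^D$ of all nonzero locally nilpotent derivations $D$ of $A$. *)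

theory Defs
  imports
    Complex_Main
    "HOL-Algebra.Algebra"
    "HOL-Algebra.Algebraic_Closure_Type"
    "HOL-Library.Extended_Nat"
    "HOL-Library.Poly_Mapping"
begin

abbreviation complex_field :: "complex ring" where
  "complex_field \<equiv> ring_of_type_algebra"

(* The supremum of the lengths of strict chains of prime ideals P 0 < ... < P n;
   the zero ring, which has no prime ideals, gets the value 0. *)
definition krull_dim :: "('a, 'b) ring_scheme \<Rightarrow> enat" where
  "krull_dim R = Sup {enat n | n.
     \<exists>P. (\<forall>i\<le>n. primeideal (P i) R) \<and> (\<forall>i<n. P i \<subset> P (Suc i))}"

definition complex_subalgebra :: "'a set \<Rightarrow> (complex, 'a) module \<Rightarrow> bool" where
  "complex_subalgebra B A \<longleftrightarrow>
     subring B A \<and> (\<forall>c. \<forall>b\<in>B. c \<odot>\<^bsub>A\<^esub> b \<in> B)"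

definition generated_subalgebra :: "(complex, 'a) module \<Rightarrow> 'a set \<Rightarrow> 'a set" where
  "generated_subalgebra A S = \<Inter>{B. complex_subalgebra B A \<and> S \<subseteq> B}"

definition finitely_generated_subalgebra :: "(complex, 'a) module \<Rightarrow> 'a set \<Rightarrow> bool" where
  "finitely_generated_subalgebra A B \<longleftrightarrow>
     (\<exists>S. finite S \<and> S \<subseteq> carrier A \<and> B = generated_subalgebra A S)"

(* Only the values of D on the carrier of A are meaningful. *)
definition is_derivation :: "(complex, 'a) module \<Rightarrow> ('a \<Rightarrow> 'a) \<Rightarrow> bool" where
  "is_derivation A D \<longleftrightarrow>
     D \<in> carrier A \<rightarrow> carrier A \<and>
     (\<forall>a\<in>carrier A. \<forall>b\<in>carrier A. D (a \<oplus>\<^bsub>A\<^esub> b) = D a \<oplus>\<^bsub>A\<^esub> D b) \<and>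
     (\<forall>c. \<forall>a\<in>carrier A. D (c \<odot>\<^bsub>A\<^esub> a) = c \<odot>\<^bsub>A\<^esub> D a) \<and>
     (\<forall>a\<in>carrier A. \<forall>b\<in>carrier A.
        D (a \<otimes>\<^bsub>A\<^esub> b) = a \<otimes>\<^bsub>A\<^esub> D b \<oplus>\<^bsub>A\<^esub> b \<otimes>\<^bsub>A\<^esub> D a)"

definition locally_nilpotent_derivation :: "(complex, 'a) module \<Rightarrow> ('a \<Rightarrow> 'a) \<Rightarrow> bool" where
  "locally_nilpotent_derivation A D \<longleftrightarrow>
     is_derivation A D \<and> (\<forall>a\<in>carrier A. \<exists>n. (D ^^ n) a = \<zero>\<^bsub>A\<^esub>)"

definition derivation_kernel :: "(complex, 'a) module \<Rightarrow> ('a \<Rightarrow> 'a) \<Rightarrow> 'a set" where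
  "derivation_kernel A D = {a \<in> carrier A. D a = \<zero>\<^bsub>A\<^esub>}"

definition makar_limanov_invariant :: "(complex, 'a) module \<Rightarrow> 'a set" where
  "makar_limanov_invariant A =
     \<Inter>{derivation_kernel A D | D. locally_nilpotent_derivation A D}"

definition derksen_invariant :: "(complex, 'a) module \<Rightarrow> 'a set" where
  "derksen_invariant A = generated_subalgebra A
     (\<Union>{derivation_kernel A D | D. locally_nilpotent_derivation A D \<and>
          (\<exists>a\<in>carrier A. D a \<noteq> \<zero>\<^bsub>A\<^esub>)})"

(* Polynomials over the complex numbers in the countably many variables x_0, x_1, ...
   (a monomial is a finitely supported exponent vector). *)
type_synonym complex_mpoly = "(nat \<Rightarrow>\<^sub>0 nat) \<Rightarrow>\<^sub>0 complex"

(* A theorem cannot quantify existentially over types, so existence of an algebra needs a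
   fixed carrier type.  This one is large enough to lose nothing: every finitely generated
   commutative complex algebra is isomorphic to a ring of cosets C[x_0,...,x_{n-1}]/I, whose
   elements are sets of polynomials.  The algebra operations on it remain arbitrary. *)
type_synonym complex_algebra = "(complex, complex_mpoly set) module"

end

(* Let A = C[t,1/t][eps]/(eps^2) x C[x,1/x,y,1/y,z,1/z].  A locally nilpotent derivation kills
   the units of a domain, so the derivative of every monomial is nilpotent, i.e. a multiple of
   eps; idempotents are constants, so the second factor is killed; and eps is killed as well,
   because D(eps) = q eps with q nilpotent.  Hence D(f + eps g, h) = (eps q t df/dt, 0) for
   some Laurent polynomial q.  All nonzero D therefore have the same kernel, the set of all
   (c + eps g, h) with a constant c.  As the eps g multiply to 0, finitely many elements of it
   generate only elements whose g is supported on finitely many exponents.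

   The second factor gives dim A >= 3.  Conversely, if P 0 < P 1 < ... < P 4 are primes and
   a i is in P (i+1) but not in P i, then the lowest term (in the lexicographic order) of a
   polynomial relation between a 0, ..., a 3 must vanish.  But any four elements of A are
   algebraically dependent, since there are about N^4 monomials of degree < N in them, which
   lie in a space of dimension O(N^3). *)

theory Submission
  imports Defs "HOL-Library.Product_Plus" "HOL-Library.Product_Lexorder"
begin

section \<open>Laurent polynomials\<close>

text \<open>The lexicographic order makes the Laurent polynomials in three variables an \<open>idom\<close>.\<close>
instance prod :: (linordered_ab_group_add, linordered_ab_group_add) linordered_ab_group_add
  by intro_classes (auto simp: less_eq_prod_def)

lemma single_eq_0_iff [simp]: "Poly_Mapping.single k c = 0 \<longleftrightarrow> c = 0"
  by (metis lookup_single_eq lookup_zero single_zero)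

lemma poly_mapping_sum_single:
  fixes f :: "'a \<Rightarrow>\<^sub>0 'b::comm_monoid_add"
  shows "(\<Sum>k\<in>Poly_Mapping.keys f. Poly_Mapping.single k (Poly_Mapping.lookup f k)) = f"
proof (rule poly_mapping_eqI)
  fix k
  show "Poly_Mapping.lookup (\<Sum>k\<in>Poly_Mapping.keys f. Poly_Mapping.single k (Poly_Mapping.lookup f k)) k
    = Poly_Mapping.lookup f k"
    by (simp add: lookup_sum lookup_single when_def in_keys_iff)
qed

text \<open>A finitely supported function is the finite sum of its monomials, so properties stable
  under sums need checking only on monomials.\<close>

lemma poly_mapping_single_induct [case_names zero single add]:
  fixes f :: "'a \<Rightarrow>\<^sub>0 'b::comm_monoid_add"
  assumes "P 0" "\<And>k c. P (Poly_Mapping.single k c)" "\<And>f g. P f \<Longrightarrow> P g \<Longrightarrow> P (f + g)"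
  shows "P f"
proof -
  have "P (\<Sum>k\<in>K. Poly_Mapping.single k (Poly_Mapping.lookup f k))" if "finite K" for K
    using that by induction (auto intro: assms)
  from this[OF finite_keys, of f] show ?thesis by (simp only: poly_mapping_sum_single)
qed

section \<open>Homomorphisms induced by maps of exponents\<close>

text \<open>For additive \<open>s\<close> this is the induced homomorphism of group algebras. A
  Laurent variable whose exponent \<open>s\<close> sends to 0 is specialised to 1.\<close>

definition push :: "('a \<Rightarrow> 'b) \<Rightarrow> ('a \<Rightarrow>\<^sub>0 complex) \<Rightarrow> ('b \<Rightarrow>\<^sub>0 complex)" where
  "push s f = (\<Sum>k\<in>Poly_Mapping.keys f. Poly_Mapping.single (s k) (Poly_Mapping.lookup f k))"

lemma push_zero [simp]: "push s 0 = 0"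
  by (simp add: push_def)

lemma push_single [simp]: "push s (Poly_Mapping.single k c) = Poly_Mapping.single (s k) c"
  by (cases "c = 0") (auto simp: push_def)

lemma push_add: "push s (f + g) = push s f + push s g"
  unfolding push_def by (rule setsum_keys_plus_distrib) (auto simp: single_add)

lemma push_one: "s 0 = 0 \<Longrightarrow> push s 1 = 1"
  by (simp flip: single_one)

lemma push_mult:
  fixes s :: "'a::comm_monoid_add \<Rightarrow> 'b::comm_monoid_add"
  assumes "\<And>i j. s (i + j) = s i + s j"
  shows "push s (f * g) = push s f * push s g"
proof (induction f rule: poly_mapping_single_induct)
  case (single k c)
  show ?case
    by (induction g rule: poly_mapping_single_induct)
      (auto simp: mult_single assms distrib_left push_add)
qed (auto simp: push_add distrib_right)

lemma push_comp: "push s (push t f) = push (s \<circ> t) f"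
  by (induction f rule: poly_mapping_single_induct) (auto simp: push_add)

section \<open>The Euler derivation\<close>

type_synonym laurent = "int \<Rightarrow>\<^sub>0 complex"

text \<open>The Euler derivation \<open>t d/dt\<close>, which avoids the shift of exponents.\<close>
definition euler :: "laurent \<Rightarrow> laurent" where
  "euler f = Poly_Mapping.mapp (\<lambda>i c. of_int i * c) f"

lemma lookup_euler: "Poly_Mapping.lookup (euler f) i = of_int i * Poly_Mapping.lookup f i"
  by (simp add: euler_def lookup_mapp when_def in_keys_iff)

lemma euler_add: "euler (f + g) = euler f + euler g"
  by (rule poly_mapping_eqI) (simp add: lookup_euler lookup_add distrib_left)

lemma euler_zero [simp]: "euler 0 = 0"
  by (rule poly_mapping_eqI) (simp add: lookup_euler)

lemma euler_single [simp]:
  "euler (Poly_Mapping.single i c) = Poly_Mapping.single i (of_int i * c)"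
  by (rule poly_mapping_eqI) (simp add: lookup_euler lookup_single when_def)

lemma euler_mult: "euler (f * g) = f * euler g + g * euler f"
proof (induction f rule: poly_mapping_single_induct)
  case (single k c)
  show ?case
    by (induction g rule: poly_mapping_single_induct)
      (auto simp: mult_single euler_add algebra_simps simp flip: single_add)
qed (auto simp: euler_add algebra_simps)

lemma euler_eq_0_iff: "euler f = 0 \<longleftrightarrow> f = Poly_Mapping.single 0 (Poly_Mapping.lookup f 0)"
proof
  assume "euler f = 0"
  then have "of_int i * Poly_Mapping.lookup f i = 0" for i
    by (metis lookup_euler lookup_zero)
  then show "f = Poly_Mapping.single 0 (Poly_Mapping.lookup f 0)"
    by (intro poly_mapping_eqI) (auto simp: lookup_single when_def)
next
  assume "f = Poly_Mapping.single 0 (Poly_Mapping.lookup f 0)"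
  then show "euler f = 0"
    by (metis euler_single mult_zero_left of_int_0 single_zero)
qed

section \<open>Transport of complex algebras\<close>

text \<open>The biconditional merges absorption (right to left) with primality (left to right).
  Negatives come from absorption, by multiplying with -1.\<close>

definition prime_ideal :: "'a::comm_ring_1 set \<Rightarrow> bool" where
  "prime_ideal P \<longleftrightarrow> 0 \<in> P \<and> 1 \<notin> P \<and> (\<forall>x\<in>P. \<forall>y\<in>P. x + y \<in> P) \<and>
     (\<forall>x y. x * y \<in> P \<longleftrightarrow> x \<in> P \<or> y \<in> P)"

text \<open>Here \<open>inc\<close> is the structure map of a complex algebra on the type \<open>'a\<close>, and \<open>code\<close>
  transports this algebra to another type.\<close>
locale coded_algebra =
  fixes inc :: "complex \<Rightarrow> 'a::comm_ring_1" and code :: "'a \<Rightarrow> 'b"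
  assumes inj_code: "inj code"
    and inc_one: "inc 1 = 1"
    and inc_add: "inc (a + b) = inc a + inc b"
    and inc_mult: "inc (a * b) = inc a * inc b"
begin

definition decode :: "'b \<Rightarrow> 'a" where "decode = inv_into UNIV code"

lemma decode_code [simp]: "decode (code x) = x"
  by (simp add: decode_def inj_code)

lemma code_eq_iff [simp]: "code x = code y \<longleftrightarrow> x = y"
  using inj_code by (simp add: inj_eq)

lemma code_mem_iff [simp]: "code x \<in> code ` C \<longleftrightarrow> x \<in> C"
  by auto

lemma inc_zero: "inc 0 = 0"
  using inc_add[of 0 0] by simp

lemma inc_minus_one: "inc (- 1) * x = - x"
proof -
  have "inc (- 1) + 1 = 0" using inc_add[of "- 1" 1] by (simp add: inc_zero inc_one)
  then have "inc (- 1) = - 1" by (simp add: eq_neg_iff_add_eq_0)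
  then show ?thesis by simp
qed

definition coded :: "(complex, 'b) module" where
  "coded = \<lparr>carrier = range code,
     monoid.mult = (\<lambda>x y. code (decode x * decode y)), one = code 1,
     ring.zero = code 0, add = (\<lambda>x y. code (decode x + decode y)),
     module.smult = (\<lambda>c x. code (inc c * decode x))\<rparr>"

lemma coded_sel [simp]:
  "carrier coded = range code"
  "one coded = code 1"
  "ring.zero coded = code 0"
  "monoid.mult coded x y = code (decode x * decode y)"
  "add coded x y = code (decode x + decode y)"
  "module.smult coded c x = code (inc c * decode x)"
  by (simp_all add: coded_def)

lemma cring_coded: "cring coded"
proof (rule cringI)
  show "abelian_group coded"
  proof (rule abelian_groupI)
    fix x assume "x \<in> carrier coded"
    then show "\<exists>y\<in>carrier coded. y \<oplus>\<^bsub>coded\<^esub> x = \<zero>\<^bsub>coded\<^esub>"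
      by (auto intro!: exI[of _ "- decode x"])
  qed (auto simp: algebra_simps)
  show "Group.comm_monoid coded"
    by (rule comm_monoidI) (auto simp: algebra_simps)
qed (auto simp: algebra_simps)

lemma algebra_coded: "algebra complex_field coded"
  by (rule algebraI)
    (auto simp: ring_of_type_algebra_def inc_one inc_add inc_mult algebra_simps
      intro: cring_coded cring_from_type_algebra[unfolded ring_of_type_algebra_def])

lemma primeideal_coded_iff:
  "primeideal (code ` P) coded \<longleftrightarrow> prime_ideal P"
proof
  assume "primeideal (code ` P) coded"
  then interpret primeideal "code ` P" coded .
  have 0: "0 \<in> P" using additive_subgroup.zero_closed[OF is_additive_subgroup] by simp
  have add: "x + y \<in> P" if "x \<in> P" "y \<in> P" for x y
    using additive_subgroup.a_closed[OF is_additive_subgroup, of "code x" "code y"] that by simp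
  have absorb: "x * y \<in> P" if "x \<in> P" for x y
    using I_r_closed[of "code x" "code y"] that by simp
  have prime: "x \<in> P \<or> y \<in> P" if "x * y \<in> P" for x y
    using I_prime[of "code x" "code y"] that by simp
  have one: "1 \<notin> P"
  proof
    assume "1 \<in> P"
    then have "x \<in> P" for x using absorb[of 1 x] by simp
    then have "P = UNIV" by auto
    then show False using I_notcarr by simp
  qed
  show "prime_ideal P"
    unfolding prime_ideal_def
    using 0 add absorb prime one by (metis mult.commute)
next
  assume P: "prime_ideal P"
  have m: "- x \<in> P" if "x \<in> P" for x
    using P that unfolding prime_ideal_def by (metis inc_minus_one)
  show "primeideal (code ` P) coded"
  proof (rule primeidealI)
    interpret cring coded by (rule cring_coded)
    show "ideal (code ` P) coded"
    proof (rule idealI)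
      show "ring coded" by (rule ring_axioms)
      show "subgroup (code ` P) (add_monoid coded)"
      proof (rule add.subgroupI)
        fix a assume a: "a \<in> code ` P"
        then obtain x where x: "x \<in> P" "a = code x" by auto
        have "\<ominus>\<^bsub>coded\<^esub> a = code (- x)"
          by (rule minus_equality) (auto simp: x)
        then show "\<ominus>\<^bsub>coded\<^esub> a \<in> code ` P" using m x by auto
      qed (use P in \<open>auto simp: prime_ideal_def\<close>)
    qed (use P in \<open>auto simp: prime_ideal_def\<close>)
    show "cring coded" by (rule cring_coded)
    have "code 1 \<notin> code ` P" using P by (simp add: prime_ideal_def)
    then show "carrier coded \<noteq> code ` P" by (metis coded_sel(1) rangeI)
  qed (use P in \<open>auto simp: prime_ideal_def\<close>)
qed

text \<open>Ideals of \<open>coded\<close> lie in the range of \<open>code\<close>, so preimages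
  turn its chains of primes into chains on the original type. The given chain attains the supremum
  and \<open>bound\<close> caps it.\<close>

lemma krull_dim_coded:
  fixes P :: "nat \<Rightarrow> 'a set"
  assumes chain: "\<And>i. i \<le> n \<Longrightarrow> prime_ideal (P i)" "\<And>i. i < n \<Longrightarrow> P i \<subset> P (Suc i)"
    and bound: "\<And>m (Q :: nat \<Rightarrow> 'a set). (\<And>i. i \<le> m \<Longrightarrow> prime_ideal (Q i)) \<Longrightarrow>
      (\<And>i. i < m \<Longrightarrow> Q i \<subset> Q (Suc i)) \<Longrightarrow> m \<le> n"
  shows "krull_dim coded = enat n"
proof -
  let ?S = "{enat n | n. \<exists>P. (\<forall>i\<le>n. primeideal (P i) coded) \<and> (\<forall>i<n. P i \<subset> P (Suc i))}"
  have "enat n \<in> ?S"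
    using chain by (auto intro!: exI[of _ "\<lambda>i. code ` P i"] simp: primeideal_coded_iff)
      (simp_all add: psubset_eq inj_image_eq_iff[OF inj_code])
  moreover have "k \<le> enat n" if "k \<in> ?S" for k
  proof -
    from that obtain m Q where k: "k = enat m"
      and Q: "\<And>i. i \<le> m \<Longrightarrow> primeideal (Q i) coded" "\<And>i. i < m \<Longrightarrow> Q i \<subset> Q (Suc i)" by blast
    have sub: "Q i = code ` (code -` Q i)" if "i \<le> m" for i
      using additive_subgroup.a_subset[OF ideal.axioms(1)[OF primeideal.axioms(1)[OF Q(1)[OF that]]]]
      by auto
    have "m \<le> n"
    proof (rule bound)
      show "prime_ideal (code -` Q i)" if "i \<le> m" for i
        using Q(1)[OF that] sub[OF that] primeideal_coded_iff by metis
      show "code -` Q i \<subset> code -` Q (Suc i)" if "i < m" for i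
      proof -
        have "code ` (code -` Q i) \<subset> code ` (code -` Q (Suc i))"
          using Q(2)[OF that] sub[of i] sub[of "Suc i"] that by simp
        then show ?thesis by auto
      qed
    qed
    then show ?thesis by (simp add: k)
  qed
  ultimately show ?thesis unfolding krull_dim_def by (intro antisym Sup_upper Sup_least)
qed

section \<open>Generated subalgebras under transport\<close>

definition subalg :: "'a set \<Rightarrow> bool" where
  "subalg C \<longleftrightarrow> 1 \<in> C \<and> (\<forall>x\<in>C. \<forall>y\<in>C. x + y \<in> C \<and> x * y \<in> C) \<and> (\<forall>c. \<forall>x\<in>C. inc c * x \<in> C)"

definition gen :: "'a set \<Rightarrow> 'a set" where
  "gen S = \<Inter>{C. subalg C \<and> S \<subseteq> C}"

lemma complex_subalgebra_coded_iff: "complex_subalgebra (code ` C) coded \<longleftrightarrow> subalg C"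
proof
  assume C: "complex_subalgebra (code ` C) coded"
  then have sr: "subring (code ` C) coded" by (simp add: complex_subalgebra_def)
  show "subalg C"
    unfolding subalg_def
  proof (intro conjI ballI allI)
    show "1 \<in> C" using subringE(3)[OF sr] by simp
    show "x + y \<in> C" "x * y \<in> C" if "x \<in> C" "y \<in> C" for x y
      using subringE(6,7)[OF sr, of "code x" "code y"] that by auto
    show "inc c * x \<in> C" if "x \<in> C" for c x
    proof -
      have "c \<odot>\<^bsub>coded\<^esub> code x \<in> code ` C"
        using C that unfolding complex_subalgebra_def by blast
      then show ?thesis by simp
    qed
  qed
next
  assume C: "subalg C"
  interpret cring coded by (rule cring_coded)
  have "subring (code ` C) coded"
  proof (rule subringI)
    fix h assume "h \<in> code ` C"
    then obtain x where x: "x \<in> C" "h = code x" by auto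
    have "\<ominus>\<^bsub>coded\<^esub> h = code (- x)" by (rule minus_equality) (auto simp: x)
    moreover have "- x \<in> C" using C x by (metis inc_minus_one subalg_def)
    ultimately show "\<ominus>\<^bsub>coded\<^esub> h \<in> code ` C" by simp
  qed (use C in \<open>auto simp: subalg_def\<close>)
  then show "complex_subalgebra (code ` C) coded"
    using C by (auto simp: complex_subalgebra_def subalg_def)
qed

lemma complex_subalgebra_coded_image:
  assumes "complex_subalgebra B coded"
  obtains C where "B = code ` C" "subalg C"
proof
  have "B \<subseteq> range code"
    using assms subringE(1)[of B coded] by (simp add: complex_subalgebra_def)
  then show *: "B = code ` (code -` B)" by auto
  show "subalg (code -` B)"
    using assms * complex_subalgebra_coded_iff by metis
qed

lemma subalg_UNIV: "subalg UNIV"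
  by (simp add: subalg_def)

lemma generated_subalgebra_coded: "generated_subalgebra coded (code ` S) = code ` gen S"
proof -
  have "{B. complex_subalgebra B coded \<and> code ` S \<subseteq> B} = (`) code ` {C. subalg C \<and> S \<subseteq> C}"
    (is "?L = ?R")
  proof
    show "?L \<subseteq> ?R"
    proof
      fix B assume B: "B \<in> ?L"
      then obtain C where "B = code ` C" "subalg C"
        using complex_subalgebra_coded_image by blast
      moreover from this B have "S \<subseteq> C" by (auto simp: inj_image_subset_iff[OF inj_code])
      ultimately show "B \<in> ?R" by blast
    qed
    show "?R \<subseteq> ?L" by (auto simp: complex_subalgebra_coded_iff)
  qed
  \<comment> \<open>\<open>code\<close> is not assumed surjective, so its image commutes only with
    intersections of nonempty families.\<close>
  moreover have "{C. subalg C \<and> S \<subseteq> C} \<noteq> {}" using subalg_UNIV by auto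
  ultimately show ?thesis
    unfolding generated_subalgebra_def gen_def
    using image_INT[of code UNIV "{C. subalg C \<and> S \<subseteq> C}" id] inj_code by auto
qed

lemma finitely_generated_coded_iff:
  "finitely_generated_subalgebra coded (code ` C) \<longleftrightarrow> (\<exists>S. finite S \<and> C = gen S)"
proof
  assume "finitely_generated_subalgebra coded (code ` C)"
  then obtain T where T: "finite T" "T \<subseteq> range code" "code ` C = generated_subalgebra coded T"
    by (auto simp: finitely_generated_subalgebra_def)
  then obtain S where S: "T = code ` S" by (metis subset_imageE)
  have "finite S" using T(1) S inj_code by (metis finite_imageD inj_on_subset subset_UNIV)
  moreover have "C = gen S"
    using T(3) inj_image_eq_iff[OF inj_code] by (simp add: S generated_subalgebra_coded)
  ultimately show "\<exists>S. finite S \<and> C = gen S" by blast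
next
  assume "\<exists>S. finite S \<and> C = gen S"
  then show "finitely_generated_subalgebra coded (code ` C)"
    unfolding finitely_generated_subalgebra_def
    by (metis coded_sel(1) finite_imageI generated_subalgebra_coded image_mono subset_UNIV)
qed

section \<open>Derivations and the two invariants under transport\<close>

definition lnd :: "('a \<Rightarrow> 'a) \<Rightarrow> bool" where
  "lnd d \<longleftrightarrow> (\<forall>x y. d (x + y) = d x + d y) \<and> (\<forall>c x. d (inc c * x) = inc c * d x) \<and>
     (\<forall>x y. d (x * y) = x * d y + y * d x) \<and> (\<forall>x. \<exists>n. (d ^^ n) x = 0)"

lemma lnd_decode:
  assumes "locally_nilpotent_derivation coded D"
  shows "lnd (\<lambda>x. decode (D (code x)))"
    and "D (code x) = code (decode (D (code x)))"
proof -
  let ?d = "\<lambda>x. decode (D (code x))"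
  have D: "is_derivation coded D" and nil: "\<And>a. a \<in> range code \<Longrightarrow> \<exists>n. (D ^^ n) a = code 0"
    using assms by (auto simp: locally_nilpotent_derivation_def)
  have dc: "D (code x) = code (?d x)" for x
  proof -
    have "D (code x) \<in> range code" using D by (auto simp: is_derivation_def)
    then show ?thesis by auto
  qed
  show "D (code x) = code (?d x)" by (rule dc)
  have pow: "(D ^^ n) (code x) = code ((?d ^^ n) x)" for n x
  proof (induction n)
    case (Suc n)
    then show ?case using dc[of "(?d ^^ n) x"] by simp
  qed simp
  show "lnd ?d"
    unfolding lnd_def
  proof (intro conjI allI)
    fix x y c
    have "D (code x \<oplus>\<^bsub>coded\<^esub> code y) = D (code x) \<oplus>\<^bsub>coded\<^esub> D (code y)"
      "D (c \<odot>\<^bsub>coded\<^esub> code x) = c \<odot>\<^bsub>coded\<^esub> D (code x)"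
      "D (code x \<otimes>\<^bsub>coded\<^esub> code y)
        = code x \<otimes>\<^bsub>coded\<^esub> D (code y) \<oplus>\<^bsub>coded\<^esub> code y \<otimes>\<^bsub>coded\<^esub> D (code x)"
      using D unfolding is_derivation_def coded_sel(1) by blast+
    then show "?d (x + y) = ?d x + ?d y" "?d (inc c * x) = inc c * ?d x"
      "?d (x * y) = x * ?d y + y * ?d x"
      by simp_all
    show "\<exists>n. (?d ^^ n) x = 0" using nil[of "code x"] by (simp add: pow)
  qed
qed

lemma lnd_code:
  assumes "lnd d"
  shows "locally_nilpotent_derivation coded (\<lambda>a. code (d (decode a)))"
proof -
  have pow: "((\<lambda>a. code (d (decode a))) ^^ n) (code x) = code ((d ^^ n) x)" for n x
    by (induction n) auto
  then show ?thesis
    using assms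
    by (auto simp: locally_nilpotent_derivation_def is_derivation_def lnd_def)
qed

lemma kernels_coded:
  "{derivation_kernel coded D | D. locally_nilpotent_derivation coded D}
    = {code ` {x. d x = 0} | d. lnd d}"
  "{derivation_kernel coded D | D. locally_nilpotent_derivation coded D \<and>
      (\<exists>a\<in>carrier coded. D a \<noteq> \<zero>\<^bsub>coded\<^esub>)}
    = {code ` {x. d x = 0} | d. lnd d \<and> (\<exists>x. d x \<noteq> 0)}"
proof -
  have 1: "\<exists>d. derivation_kernel coded D = code ` {x. d x = 0} \<and> lnd d \<and>
      ((\<exists>a\<in>carrier coded. D a \<noteq> \<zero>\<^bsub>coded\<^esub>) \<longrightarrow> (\<exists>x. d x \<noteq> 0))"
    if D: "locally_nilpotent_derivation coded D" for D
  proof (intro exI conjI)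
    let ?d = "\<lambda>x. decode (D (code x))"
    show "lnd ?d" by (rule lnd_decode(1)[OF D])
    have eq: "D (code x) = code 0 \<longleftrightarrow> ?d x = 0" for x
      by (metis lnd_decode(2)[OF D] decode_code)
    show "derivation_kernel coded D = code ` {x. ?d x = 0}"
      by (auto simp: derivation_kernel_def eq)
    show "(\<exists>a\<in>carrier coded. D a \<noteq> \<zero>\<^bsub>coded\<^esub>) \<longrightarrow> (\<exists>x. ?d x \<noteq> 0)"
      by (auto simp: eq)
  qed
  have 2: "\<exists>D. code ` {x. d x = 0} = derivation_kernel coded D \<and>
      locally_nilpotent_derivation coded D \<and>
      ((\<exists>x. d x \<noteq> 0) \<longrightarrow> (\<exists>a\<in>carrier coded. D a \<noteq> \<zero>\<^bsub>coded\<^esub>))" if "lnd d" for d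
    by (rule exI[of _ "\<lambda>a. code (d (decode a))"])
      (use lnd_code[OF that] in \<open>auto simp: derivation_kernel_def\<close>)
  show "{derivation_kernel coded D | D. locally_nilpotent_derivation coded D}
    = {code ` {x. d x = 0} | d. lnd d}" (is "?L = ?R")
  proof (intro equalityI subsetI)
    fix K assume "K \<in> ?L"
    then obtain D where D: "K = derivation_kernel coded D" "locally_nilpotent_derivation coded D"
      by blast
    from 1[OF D(2)] D(1) show "K \<in> ?R" by blast
  next
    fix K assume "K \<in> ?R"
    then obtain d where d: "K = code ` {x. d x = 0}" "lnd d" by blast
    from 2[OF d(2)] d(1) show "K \<in> ?L" by blast
  qed
  show "{derivation_kernel coded D | D. locally_nilpotent_derivation coded D \<and>
      (\<exists>a\<in>carrier coded. D a \<noteq> \<zero>\<^bsub>coded\<^esub>)}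
    = {code ` {x. d x = 0} | d. lnd d \<and> (\<exists>x. d x \<noteq> 0)}"
    (is "?L = ?R")
  proof (intro equalityI subsetI)
    fix K assume "K \<in> ?L"
    then obtain D where D: "K = derivation_kernel coded D" "locally_nilpotent_derivation coded D"
      "\<exists>a\<in>carrier coded. D a \<noteq> \<zero>\<^bsub>coded\<^esub>" by blast
    from 1[OF D(2)] D(1,3) show "K \<in> ?R" by blast
  next
    fix K assume "K \<in> ?R"
    then obtain d where d: "K = code ` {x. d x = 0}" "lnd d" "\<exists>x. d x \<noteq> 0" by blast
    from 2[OF d(2)] d(1,3) show "K \<in> ?L" by blast
  qed
qed

text \<open>Only the zero derivation can have a kernel other than \<open>B\<close>. That kernel is
  everything, so it does not affect the intersection, and the Derksen invariant excludes it. As a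
  subalgebra, \<open>B\<close> generates only itself.\<close>

lemma invariants_coded:
  assumes kernel: "\<And>d x. lnd d \<Longrightarrow> d x \<noteq> 0 \<Longrightarrow> {x. d x = 0} = B"
    and ex: "lnd d0" "d0 x0 \<noteq> 0" and B: "subalg B"
  shows "makar_limanov_invariant coded = code ` B" "derksen_invariant coded = code ` B"
proof -
  have kernel_image: "code ` {x. d x = 0} = code ` B" if "lnd d" "d x \<noteq> 0" for d x
    using kernel[OF that] by simp
  have *: "{code ` {x. d x = 0} | d. lnd d \<and> (\<exists>x. d x \<noteq> 0)} = {code ` B}"
    (is "?L = _")
  proof (intro equalityI subsetI)
    fix K assume "K \<in> ?L"
    then obtain d x where "K = code ` {x. d x = 0}" "lnd d" "d x \<noteq> 0" by blast
    then show "K \<in> {code ` B}" by (simp add: kernel_image)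
  next
    fix K assume "K \<in> {code ` B}"
    then have "K = code ` {x. d0 x = 0}" by (simp add: kernel_image[OF ex])
    then show "K \<in> ?L" using ex by blast
  qed
  show "makar_limanov_invariant coded = code ` B"
    unfolding makar_limanov_invariant_def kernels_coded
  proof (intro equalityI subsetI InterI)
    fix a assume "a \<in> \<Inter>{code ` {x. d x = 0} | d. lnd d}"
    then have "a \<in> code ` {x. d0 x = 0}" using ex(1) by blast
    then show "a \<in> code ` B" by (simp only: kernel_image[OF ex])
  next
    fix a K assume a: "a \<in> code ` B" and "K \<in> {code ` {x. d x = 0} | d. lnd d}"
    then obtain d where d: "K = code ` {x. d x = 0}" "lnd d" by blast
    show "a \<in> K"
    proof (cases "\<exists>x. d x \<noteq> 0")
      case True
      then show ?thesis using d a kernel_image by metis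
    next
      case False
      then show ?thesis using d a by auto
    qed
  qed
  have "gen B = B" using B by (auto simp: gen_def)
  then show "derksen_invariant coded = code ` B"
    unfolding derksen_invariant_def kernels_coded * by (simp add: generated_subalgebra_coded)
qed

end

section \<open>Locally nilpotent derivations\<close>

context coded_algebra
begin

lemma lnd_add: "lnd d \<Longrightarrow> d (x + y) = d x + d y"
  and lnd_mult: "lnd d \<Longrightarrow> d (x * y) = x * d y + y * d x"
  and lnd_scale: "lnd d \<Longrightarrow> d (inc c * x) = inc c * d x"
  by (auto simp: lnd_def)

lemma lnd_zero [simp]: "lnd d \<Longrightarrow> d 0 = 0"
  using lnd_add[of d 0 0] by simp

text \<open>The Leibniz rule gives \<open>d e = e * d e + e * d e\<close>; multiplying by
  \<open>e\<close> yields \<open>e * d e = 0\<close>.\<close>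

lemma lnd_idempotent:
  assumes "lnd d" "e * e = e"
  shows "d e = 0"
proof -
  have 1: "d e = e * d e + e * d e" using lnd_mult[OF assms(1), of e e] assms(2) by simp
  then have "e * d e = e * (e * d e + e * d e)" by simp
  also have "\<dots> = e * d e + e * d e" by (metis assms(2) distrib_left mult.assoc)
  finally have "e * d e = 0" by simp
  with 1 show ?thesis by simp
qed

lemma lnd_one: "lnd d \<Longrightarrow> d 1 = 0"
  by (simp add: lnd_idempotent)

lemma lnd_pow_add: "lnd d \<Longrightarrow> (d ^^ n) (x + y) = (d ^^ n) x + (d ^^ n) y"
  by (induction n) (auto simp: lnd_add)

lemma lnd_pow_zero: "lnd d \<Longrightarrow> (d ^^ n) 0 = 0"
  by (induction n) auto

text \<open>Expanding the innermost derivation leaves iterates of products again, so induction on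
  the order can replace the binomial Leibniz formula.\<close>

lemma lnd_pow_Suc_mult:
  assumes "lnd d"
  shows "(d ^^ Suc n) (x * y) = (d ^^ n) (x * d y) + (d ^^ n) (d x * y)"
proof -
  have "(d ^^ Suc n) (x * y) = (d ^^ n) (d (x * y))" by (simp only: funpow_Suc_right comp_apply)
  then show ?thesis
    using assms by (simp add: lnd_mult lnd_pow_add mult.commute)
qed

text \<open>With \<open>m\<close> and \<open>n\<close> the largest orders for which the images of the iterated derivatives of
  \<open>u\<close> and \<open>v\<close> do not vanish, only one term of the Leibniz expansion of \<open>(d ^^ (m + n)) (u * v)\<close>
  survives in the domain \<open>'c\<close>. Hence \<open>m + n = 0\<close> if \<open>u * v = 1\<close>.\<close>
lemma lnd_unit:
  fixes p :: "'a \<Rightarrow> 'c::{idom, ring_char_0}"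
  assumes d: "lnd d" and uv: "u * v = 1"
    and p: "\<And>x y. p (x + y) = p x + p y" "\<And>x y. p (x * y) = p x * p y" "p 1 = 1"
  shows "p (d u) = 0"
proof (rule ccontr)
  assume du: "p (d u) \<noteq> 0"
  have p0: "p 0 = 0" using p(1)[of 0 0] by simp
  \<comment> \<open>The kernel of \<open>p\<close> need not be stable under \<open>d\<close>, so
    images of iterates may vanish and reappear. Local nilpotency still bounds the orders with
    nonzero image, so a largest one exists.\<close>
  have last: "\<exists>m\<ge>k. p ((d ^^ m) x) \<noteq> 0 \<and> (\<forall>i>m. p ((d ^^ i) x) = 0)"
    if nz: "p ((d ^^ k) x) \<noteq> 0" for k x
  proof -
    obtain N where N: "(d ^^ N) x = 0" using d unfolding lnd_def by blast
    have bound: "i \<le> N" if i: "p ((d ^^ i) x) \<noteq> 0" for i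
    proof (rule ccontr)
      assume "\<not> i \<le> N"
      then have "i = (i - N) + N" by simp
      then have "(d ^^ i) x = (d ^^ (i - N)) ((d ^^ N) x)" by (metis comp_apply funpow_add)
      then show False using i N d p0 by (simp add: lnd_pow_zero)
    qed
    let ?m = "GREATEST i. p ((d ^^ i) x) \<noteq> 0"
    have 1: "p ((d ^^ ?m) x) \<noteq> 0"
      by (rule GreatestI_nat[where P = "\<lambda>i. p ((d ^^ i) x) \<noteq> 0", OF nz bound])
    have 2: "i \<le> ?m" if "p ((d ^^ i) x) \<noteq> 0" for i
      by (rule Greatest_le_nat[where P = "\<lambda>i. p ((d ^^ i) x) \<noteq> 0", OF that bound])
    show ?thesis
    proof (intro exI[of _ ?m] conjI allI impI)
      show "k \<le> ?m" using 2 nz .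
      show "p ((d ^^ ?m) x) \<noteq> 0" by (rule 1)
      show "p ((d ^^ i) x) = 0" if "?m < i" for i using 2[of i] that by (meson leD)
    qed
  qed
  have "p u * p v = 1" by (simp add: p(3) uv flip: p(2))
  then have "p ((d ^^ 0) v) \<noteq> 0" by auto
  then obtain n where n: "p ((d ^^ n) v) \<noteq> 0" "\<And>i. i > n \<Longrightarrow> p ((d ^^ i) v) = 0"
    using last by blast
  have "p ((d ^^ 1) u) \<noteq> 0" using du by simp
  then obtain m where m: "m \<ge> 1" "p ((d ^^ m) u) \<noteq> 0" "\<And>i. i > m \<Longrightarrow> p ((d ^^ i) u) = 0"
    using last by blast
  \<comment> \<open>Each Leibniz term contains a derivative of \<open>x\<close> of order at least
    \<open>i\<close>, whose image is 0.\<close>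
  have vanish: "p ((d ^^ N) ((d ^^ i) x * y)) = 0"
    if "\<And>i. i > l \<Longrightarrow> p ((d ^^ i) x) = 0" "i > l" for N i l x y
    using \<open>i > l\<close>
  proof (induction N arbitrary: i y)
    case 0
    then show ?case using that(1) by (simp add: p)
  next
    case (Suc N)
    have "p ((d ^^ N) ((d ^^ Suc i) x * y)) = 0" using Suc.prems by (intro Suc.IH) simp
    then show ?case
      unfolding lnd_pow_Suc_mult[OF d] p(1) using Suc.IH[OF Suc.prems] by simp
  qed
  \<comment> \<open>\<open>N\<close> is exactly the number of derivatives missing to reach order
    \<open>m\<close> on \<open>u\<close> and \<open>n\<close> on \<open>v\<close>. Positivity of
    \<open>c\<close> becomes nonvanishing in characteristic 0.\<close>
  have main: "\<exists>c. c > 0 \<and> p ((d ^^ N) ((d ^^ i) u * (d ^^ j) v))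
      = of_nat c * (p ((d ^^ m) u) * p ((d ^^ n) v))"
    if "i \<le> m" "j \<le> n" "N = (m - i) + (n - j)" for N i j
    using that
  proof (induction N arbitrary: i j)
    case 0
    then have "i = m" "j = n" by auto
    then show ?case by (intro exI[of _ 1]) (simp add: p)
  next
    case (Suc N)
    let ?t = "\<lambda>i j. p ((d ^^ N) ((d ^^ i) u * (d ^^ j) v))"
    let ?P = "\<lambda>c t. t = of_nat c * (p ((d ^^ m) u) * p ((d ^^ n) v))"
    \<comment> \<open>If \<open>i = m\<close>, the term vanishes and \<open>c = 0\<close> serves. As
      \<open>Suc N > 0\<close>, one of \<open>i < m\<close> and \<open>j < n\<close> holds, which
      keeps the total coefficient positive.\<close>
    have 1: "\<exists>c. (i < m \<longrightarrow> c > 0) \<and> ?P c (?t (Suc i) j)"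
    proof (cases "i < m")
      case True
      then have "N = (m - Suc i) + (n - j)" using Suc.prems by auto
      then show ?thesis using Suc.IH[of "Suc i" j] Suc.prems(1,2) True by (metis Suc_leI)
    next
      case False
      have "?t (Suc i) j = 0" by (rule vanish[where l = m]) (use m(3) False in simp_all)
      then show ?thesis using False by (intro exI[of _ 0]) simp
    qed
    have 2: "\<exists>c. (j < n \<longrightarrow> c > 0) \<and> ?P c (?t i (Suc j))"
    proof (cases "j < n")
      case True
      then have "N = (m - i) + (n - Suc j)" using Suc.prems by auto
      then show ?thesis using Suc.IH[of i "Suc j"] Suc.prems(1,2) True by (metis Suc_leI)
    next
      case False
      have "p ((d ^^ N) ((d ^^ Suc j) v * (d ^^ i) u)) = 0"
        by (rule vanish[where l = n]) (use n(2) False in simp_all)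
      then have "?t i (Suc j) = 0" by (simp only: mult.commute)
      then show ?thesis using False by (intro exI[of _ 0]) simp
    qed
    from 1 2 obtain a b where ab: "i < m \<longrightarrow> a > 0" "?P a (?t (Suc i) j)"
      "j < n \<longrightarrow> b > 0" "?P b (?t i (Suc j))" by blast
    have "p ((d ^^ Suc N) ((d ^^ i) u * (d ^^ j) v)) = ?t i (Suc j) + ?t (Suc i) j"
      unfolding lnd_pow_Suc_mult[OF d] p(1) by simp
    also have "\<dots> = of_nat (a + b) * (p ((d ^^ m) u) * p ((d ^^ n) v))"
      using ab by (simp add: algebra_simps)
    finally have "?P (a + b) (p ((d ^^ Suc N) ((d ^^ i) u * (d ^^ j) v)))" .
    moreover have "a + b > 0" using ab Suc.prems by auto
    ultimately show ?case by blast
  qed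
  obtain c where c: "c > 0" "p ((d ^^ (m + n)) (u * v)) = of_nat c * (p ((d ^^ m) u) * p ((d ^^ n) v))"
    using main[of 0 0 "m + n"] by auto
  \<comment> \<open>Since \<open>m\<close> is at least 1, \<open>d\<close> is applied to 1 at least
    once.\<close>
  have "(d ^^ (m + n)) 1 = (d ^^ (m + n - 1)) (d 1)"
    using m(1) by (metis One_nat_def Suc_pred add_gr_0 comp_apply funpow_Suc_right less_eq_Suc_le)
  then have "p ((d ^^ (m + n)) (u * v)) = 0"
    using d by (simp add: uv lnd_one lnd_pow_zero p0)
  then show False using c m(2) n(1) by simp
qed

end

section \<open>The algebra and its coefficient vectors\<close>

text \<open>\<open>Alg f g h\<close> stands for the pair \<open>(f + \<epsilon> g, h)\<close> in
  \<open>\<complex>[t, 1/t][\<epsilon>]/(\<epsilon>\<^sup>2) \<times> \<complex>[x, 1/x, y, 1/y, z, 1/z]\<close>; the exponents of \<open>x, y, z\<close> form a triple.\<close>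
datatype alg = Alg (base: laurent) (nilp: laurent) (tor: "int \<times> int \<times> int \<Rightarrow>\<^sub>0 complex")

lemma alg_eqI: "base x = base y \<Longrightarrow> nilp x = nilp y \<Longrightarrow> tor x = tor y \<Longrightarrow> x = y"
  by (simp add: alg.expand)

instantiation alg :: comm_ring_1
begin

definition "0 = Alg 0 0 0"
definition "1 = Alg 1 0 1"
definition "x + y = Alg (base x + base y) (nilp x + nilp y) (tor x + tor y)"
definition "- x = Alg (- base x) (- nilp x) (- tor x)"
definition "x - y = Alg (base x - base y) (nilp x - nilp y) (tor x - tor y)" for x y :: alg
definition "x * y = Alg (base x * base y) (base x * nilp y + base y * nilp x) (tor x * tor y)"

instance
  by intro_classes
    (auto simp: zero_alg_def one_alg_def plus_alg_def uminus_alg_def minus_alg_def times_alg_def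
      algebra_simps)

end

lemma alg_sel [simp]:
  "base 0 = 0" "nilp 0 = 0" "tor 0 = 0" "base 1 = 1" "nilp 1 = 0" "tor 1 = 1"
  "base (x + y) = base x + base y" "nilp (x + y) = nilp x + nilp y" "tor (x + y) = tor x + tor y"
  "base (- x) = - base x" "nilp (- x) = - nilp x" "tor (- x) = - tor x"
  "base (x - y) = base x - base y" "nilp (x - y) = nilp x - nilp y" "tor (x - y) = tor x - tor y"
  "base (x * y) = base x * base y" "nilp (x * y) = base x * nilp y + base y * nilp x"
  "tor (x * y) = tor x * tor y"
  by (simp_all add: zero_alg_def one_alg_def plus_alg_def uminus_alg_def minus_alg_def times_alg_def)

definition const :: "complex \<Rightarrow> alg" where
  "const c = Alg (Poly_Mapping.single 0 c) 0 (Poly_Mapping.single 0 c)"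

lemma const_sel [simp]:
  "base (const c) = Poly_Mapping.single 0 c" "nilp (const c) = 0"
  "tor (const c) = Poly_Mapping.single 0 c"
  by (simp_all add: const_def)

lemma const_hom:
  "const 1 = 1" "const (a + b) = const a + const b" "const (a * b) = const a * const b"
  by (auto intro!: alg_eqI simp: single_add mult_single)

text \<open>A single countable index type serves both the encoding by \<open>to_nat\<close> and the
  later dimension count.\<close>

definition coef :: "alg \<Rightarrow> (int + int) + (int \<times> int \<times> int) \<Rightarrow> complex" where
  "coef x = case_sum (case_sum (Poly_Mapping.lookup (base x)) (Poly_Mapping.lookup (nilp x)))
     (Poly_Mapping.lookup (tor x))"

lemma coef_sel:
  "Poly_Mapping.lookup (base x) i = coef x (Inl (Inl i))"
  "Poly_Mapping.lookup (nilp x) i = coef x (Inl (Inr i))"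
  "Poly_Mapping.lookup (tor x) m = coef x (Inr m)"
  by (simp_all add: coef_def)

lemma coef_inject: "coef x = coef y \<Longrightarrow> x = y"
  by (intro alg_eqI poly_mapping_eqI) (simp_all add: coef_sel)

text \<open>Any injection into the prescribed carrier type would do; this one records each coefficient
  in a polynomial of the set.\<close>
definition code :: "alg \<Rightarrow> complex_mpoly set" where
  "code x = range (\<lambda>i. Poly_Mapping.single (Poly_Mapping.single 0 (to_nat i)) (coef x i))"

lemma inj_code: "inj code"
proof (rule injI, rule coef_inject, rule ext)
  fix x y i assume eq: "code x = code y"
  \<comment> \<open>\<open>Poly_Mapping.single k 0\<close> forgets \<open>k\<close>, so only nonzero
    coefficients can be read off. A zero coefficient is handled by exchanging \<open>x\<close> and
    \<open>y\<close>.\<close>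
  have "coef y i = c"
    if "c \<noteq> 0" "coef x i = c" "code x \<subseteq> code y" for x y c
  proof -
    let ?k = "\<lambda>i. Poly_Mapping.single (0::nat) (to_nat (i :: (int + int) + int \<times> int \<times> int))"
    have "Poly_Mapping.single (?k i) c \<in> code y" using that by (auto simp: code_def)
    then obtain j where j: "Poly_Mapping.single (?k i) c = Poly_Mapping.single (?k j) (coef y j)"
      by (auto simp: code_def)
    then have "Poly_Mapping.lookup (Poly_Mapping.single (?k j) (coef y j)) (?k i) = c"
      by (metis lookup_single_eq)
    then have *: "?k j = ?k i" "coef y j = c" using \<open>c \<noteq> 0\<close> by (auto simp: lookup_single when_def split: if_splits)
    then have "to_nat j = to_nat i" by (metis lookup_single_eq)
    then show ?thesis using * by simp
  qed
  from this[of _ x y] this[of _ y x] show "coef x i = coef y i" using eq by (metis order_refl)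
qed

interpretation A: coded_algebra const code
  by unfold_locales (auto simp: inj_code const_hom)

section \<open>Classification of the locally nilpotent derivations\<close>

lemma lnd_alg_form:
  assumes d: "A.lnd d"
  obtains q where "\<And>x. d x = Alg 0 (euler (base x) * q) 0"
proof -
  note add = A.lnd_add[OF d] and mult = A.lnd_mult[OF d] and scale = A.lnd_scale[OF d]
  let ?e = "Alg 1 0 0" and ?E = "Alg 0 1 0"
  let ?T = "\<lambda>i. Poly_Mapping.single i (1::complex)"
  have e: "d ?e = 0" by (rule A.lnd_idempotent[OF d]) (auto intro: alg_eqI)
  \<comment> \<open>Monomials in both components give a unit, and \<open>base\<close> and
    \<open>tor\<close> are homomorphisms to domains, so \<open>lnd_unit\<close> applies to
    each.\<close>
  have unit: "base (d (Alg (?T i) 0 (?T m))) = 0" "tor (d (Alg (?T i) 0 (?T m))) = 0" for i m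
  proof -
    have *: "Alg (?T i) 0 (?T m) * Alg (?T (- i)) 0 (?T (- m)) = 1"
      by (rule alg_eqI) (auto simp: mult_single)
    show "base (d (Alg (?T i) 0 (?T m))) = 0" "tor (d (Alg (?T i) 0 (?T m))) = 0"
      by (rule A.lnd_unit[OF d *]; simp)+
  qed
  \<comment> \<open>The idempotent \<open>?e\<close> is killed by \<open>d\<close>, so multiplying
    by it removes the \<open>tor\<close> component of the derivative.\<close>
  have dT: "d (Alg (?T i) 0 0) = Alg 0 (nilp (d (Alg (?T i) 0 0))) 0" for i
  proof -
    have "Alg (?T i) 0 0 = ?e * Alg (?T i) 0 (?T 0)" by (rule alg_eqI) auto
    then have "d (Alg (?T i) 0 0) = ?e * d (Alg (?T i) 0 (?T 0))" using mult e by simp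
    then show ?thesis using unit[of i 0] by (intro alg_eqI) auto
  qed
  have tor: "d (Alg 0 0 h) = 0" for h
  proof (induction h rule: poly_mapping_single_induct)
    case zero
    show ?case using d by (simp flip: zero_alg_def)
  next
    case (single m c)
    let ?f = "Alg 0 0 1"
    have f: "d ?f = 0" by (rule A.lnd_idempotent[OF d]) (auto intro: alg_eqI)
    have "Alg 0 0 (Poly_Mapping.single m c) = const c * (?f * Alg (?T 0) 0 (?T m))"
      by (rule alg_eqI) (auto simp: mult_single)
    then have "d (Alg 0 0 (Poly_Mapping.single m c)) = const c * (?f * d (Alg (?T 0) 0 (?T m)))"
      using mult f scale by simp
    also have "?f * d (Alg (?T 0) 0 (?T m)) = 0" using unit[of 0 m] by (intro alg_eqI) auto
    finally show ?case by simp
  next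
    case (add f g)
    have "Alg 0 0 (f + g) = Alg 0 0 f + Alg 0 0 g" by (rule alg_eqI) auto
    then show ?case using add d by (simp add: A.lnd_add)
  qed
  \<comment> \<open>The logarithmic derivative of the \<open>i\<close>-th power of t, read off the
    eps part: products become sums, which makes it linear in \<open>i\<close>.\<close>
  define r where "r i = ?T (- i) * nilp (d (Alg (?T i) 0 0))" for i
  have rT: "nilp (d (Alg (?T i) 0 0)) = ?T i * r i" for i
    by (simp add: r_def mult_single flip: mult.assoc)
  have r_add: "r (i + j) = r i + r j" for i j
  proof -
    have "Alg (?T (i + j)) 0 0 = Alg (?T i) 0 0 * Alg (?T j) 0 0"
      by (rule alg_eqI) (auto simp: mult_single)
    then have "nilp (d (Alg (?T (i + j)) 0 0)) = ?T i * (?T j * r j) + ?T j * (?T i * r i)"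
      using mult by (simp add: rT)
    also have "\<dots> = ?T (i + j) * (r i + r j)"
      by (simp add: algebra_simps mult_single flip: mult.assoc)
    finally have "?T (i + j) * r (i + j) = ?T (i + j) * (r i + r j)" by (simp add: rT)
    then show ?thesis by simp
  qed
  define q where "q = r 1"
  have r0: "r 0 = 0" using r_add[of 0 0] by simp
  have r_eq: "r i = of_int i * q" for i
  proof (induction i rule: int_induct[of _ 0])
    case (step1 i)
    then show ?case using r_add[of i 1] by (simp add: q_def algebra_simps)
  next
    case (step2 i)
    then show ?case using r_add[of "i - 1" 1] by (simp add: q_def algebra_simps)
  qed (simp add: r0)
  have base: "d (Alg f 0 0) = Alg 0 (euler f * q) 0" for f
  proof (induction f rule: poly_mapping_single_induct)
    case zero
    show ?case using d by (simp flip: zero_alg_def)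
  next
    case (single i c)
    have "Alg (Poly_Mapping.single i c) 0 0 = const c * Alg (?T i) 0 0"
      by (rule alg_eqI) (auto simp: mult_single)
    then have "d (Alg (Poly_Mapping.single i c) 0 0) = const c * Alg 0 (?T i * (of_int i * q)) 0"
      using scale dT[of i] rT[of i] by (simp add: r_eq)
    also have "\<dots> = Alg 0 (euler (Poly_Mapping.single i c) * q) 0"
    proof -
      have "Poly_Mapping.single i (of_int i * c) = Poly_Mapping.single 0 c * (?T i * of_int i)"
        by (simp add: mult_single mult.commute flip: single_of_int)
      then show ?thesis by (intro alg_eqI) (simp_all add: mult.assoc)
    qed
    finally show ?case .
  next
    case (add f g)
    have "Alg (f + g) 0 0 = Alg f 0 0 + Alg g 0 0" by (rule alg_eqI) auto
    moreover have "Alg 0 (euler (f + g) * q) 0 = Alg 0 (euler f * q) 0 + Alg 0 (euler g * q) 0"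
      by (rule alg_eqI) (auto simp: euler_add algebra_simps)
    ultimately show ?case using add d by (simp add: A.lnd_add)
  qed
  have E: "d ?E = 0"
  proof -
    let ?s = "nilp (d ?E)"
    \<comment> \<open>Differentiating eps^2 = 0 makes \<open>base (d ?E)\<close> vanish; multiplying
      by \<open>?e\<close> removes the \<open>tor\<close> component. So the derivative of eps is
      \<open>?s\<close> times eps.\<close>
    have "?E * ?E = 0" by (rule alg_eqI) auto
    then have "?E * d ?E + ?E * d ?E = 0" using mult[of ?E ?E] d by simp
    then have "nilp (?E * d ?E + ?E * d ?E) = 0" by (simp only: alg_sel)
    moreover have "nilp (?E * d ?E + ?E * d ?E) = 2 * base (d ?E)"
      by (simp only: alg_sel alg.sel) simp
    ultimately have "2 * base (d ?E) = 0" by metis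
    then have 1: "base (d ?E) = 0" by simp
    have "?E = ?e * ?E" by (rule alg_eqI) auto
    then have "d ?E = ?e * d ?E" using mult[of ?e ?E] e by simp
    then have "tor (d ?E) = tor (?e * d ?E)" by simp
    then have dE: "d ?E = Alg 0 ?s 0" using 1 by (intro alg_eqI) auto
    \<comment> \<open>The other Leibniz term is a multiple of eps^2 = 0, so each application of
      \<open>d\<close> contributes just a factor \<open>?s\<close>.\<close>
    have "(d ^^ n) ?E = Alg 0 (?s ^ n) 0" for n
    proof (induction n)
      case (Suc n)
      have "Alg 0 (?s ^ n) 0 = Alg (?s ^ n) 0 0 * ?E" by (rule alg_eqI) auto
      then have "d (Alg 0 (?s ^ n) 0) = Alg (?s ^ n) 0 0 * d ?E + ?E * d (Alg (?s ^ n) 0 0)"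
        by (simp only: mult)
      also have "\<dots> = Alg 0 (?s ^ Suc n) 0"
        unfolding base by (subst dE, rule alg_eqI) (auto simp: mult.commute)
      finally show ?case using Suc by simp
    qed (auto intro: alg_eqI)
    moreover obtain n where "(d ^^ n) ?E = 0" using d unfolding A.lnd_def by blast
    ultimately have "?s ^ n = 0" by (metis alg_sel(2) alg.sel(2))
    then have "?s = 0" by simp
    with dE show ?thesis by (simp add: zero_alg_def)
  qed
  have "d x = Alg 0 (euler (base x) * q) 0" for x
  proof -
    have "x = Alg (base x) 0 0 + (Alg (nilp x) 0 0 * ?E + Alg 0 0 (tor x))"
      by (rule alg_eqI) auto
    then have "d x = d (Alg (base x) 0 0) + (d (Alg (nilp x) 0 0 * ?E) + d (Alg 0 0 (tor x)))"
      by (metis add)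
    also have "\<dots> = Alg 0 (euler (base x) * q) 0 + ?E * Alg 0 (euler (nilp x) * q) 0"
      by (simp add: mult base tor E)
    also have "\<dots> = Alg 0 (euler (base x) * q) 0" by (rule alg_eqI) auto
    finally show ?thesis .
  qed
  then show thesis by (rule that)
qed

text \<open>All values have \<open>base\<close> equal to 0, so the second iterate vanishes. This is
  the witness for a nonzero locally nilpotent derivation.\<close>

lemma lnd_euler: "A.lnd (\<lambda>x. Alg 0 (euler (base x)) 0)"
  unfolding A.lnd_def
proof (intro conjI allI)
  fix x :: alg
  show "\<exists>n. ((\<lambda>x. Alg 0 (euler (base x)) 0) ^^ n) x = 0"
    by (rule exI[of _ 2]) (simp add: numeral_2_eq_2 zero_alg_def)
qed (auto intro!: alg_eqI simp: euler_add euler_mult mult_single)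

section \<open>The common kernel and its generators\<close>

definition const_base :: "alg set" where
  "const_base = {x. euler (base x) = 0}"

text \<open>Here \<open>q\<close> is nonzero and Laurent polynomials form a domain, so
  \<open>euler (base x) * q\<close> vanishes only with \<open>euler (base x)\<close>.\<close>

lemma lnd_alg_kernel:
  assumes "A.lnd d" "d x \<noteq> 0"
  shows "{x. d x = 0} = const_base"
proof -
  obtain q where q: "\<And>x. d x = Alg 0 (euler (base x) * q) 0"
    using lnd_alg_form[OF assms(1)] by blast
  have "q \<noteq> 0" using assms(2) q[of x] by (auto simp: zero_alg_def)
  then show ?thesis by (auto simp: const_base_def q zero_alg_def)
qed

lemma subalg_const_base: "A.subalg const_base"
proof -
  have 1: "euler 1 = 0" by (simp flip: single_one)
  show ?thesis by (auto simp: A.subalg_def const_base_def euler_add euler_mult 1)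
qed

lemma invariants_alg:
  "makar_limanov_invariant A.coded = code ` const_base"
  "derksen_invariant A.coded = code ` const_base"
proof -
  have nz: "Alg 0 (euler (base (Alg (Poly_Mapping.single 1 1) 0 0))) 0 \<noteq> 0"
    by (simp add: zero_alg_def)
  show "makar_limanov_invariant A.coded = code ` const_base"
    "derksen_invariant A.coded = code ` const_base"
    by (rule A.invariants_coded[OF _ lnd_euler nz subalg_const_base]; erule (1) lnd_alg_kernel)+
qed

lemma not_finitely_generated_const_base:
  "\<not> finitely_generated_subalgebra A.coded (code ` const_base)"
proof
  assume "finitely_generated_subalgebra A.coded (code ` const_base)"
  then obtain S where S: "finite S" "const_base = A.gen S"
    by (auto simp: A.finitely_generated_coded_iff)
  define F where "F = (\<Union>x\<in>S. Poly_Mapping.keys (nilp x))"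
  \<comment> \<open>Base parts in \<open>const_base\<close> are constants, so the
    \<open>nilp\<close> part of a product is a linear combination of the two \<open>nilp\<close>
    parts and its support stays in \<open>F\<close>.\<close>
  define C where "C = {x \<in> const_base. Poly_Mapping.keys (nilp x) \<subseteq> F}"
  have scale: "Poly_Mapping.keys (Poly_Mapping.single 0 c * f) \<subseteq> Poly_Mapping.keys f"
    for c and f :: laurent
    using keys_mult[of "Poly_Mapping.single 0 c" f] by (auto split: if_splits)
  have scale': "Poly_Mapping.keys (b * nilp x) \<subseteq> F" if "euler b = 0" "x \<in> C" for b x
  proof -
    have "b = Poly_Mapping.single 0 (Poly_Mapping.lookup b 0)" using that by (simp add: euler_eq_0_iff)
    then have "Poly_Mapping.keys (b * nilp x) \<subseteq> Poly_Mapping.keys (nilp x)" using scale by metis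
    then show ?thesis using that by (auto simp: C_def)
  qed
  have "A.subalg C"
    unfolding A.subalg_def
  proof (intro conjI ballI allI)
    show "1 \<in> C" using subalg_const_base by (simp add: C_def A.subalg_def)
    fix x y assume xy: "x \<in> C" "y \<in> C"
    show "x + y \<in> C"
      using xy subalg_const_base keys_add[of "nilp x" "nilp y"] by (auto simp: C_def A.subalg_def)
    have "Poly_Mapping.keys (base x * nilp y) \<subseteq> F" "Poly_Mapping.keys (base y * nilp x) \<subseteq> F"
      by (rule scale'; use xy in \<open>simp add: C_def const_base_def\<close>)+
    then have "Poly_Mapping.keys (nilp (x * y)) \<subseteq> F"
      using keys_add[of "base x * nilp y" "base y * nilp x"] by auto
    then show "x * y \<in> C"
      using xy subalg_const_base by (simp add: C_def A.subalg_def)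
  next
    fix c x assume x: "x \<in> C"
    then have "Poly_Mapping.keys (nilp (const c * x)) \<subseteq> F" by (simp add: scale')
    then show "const c * x \<in> C"
      using x subalg_const_base by (simp add: C_def A.subalg_def)
  qed
  moreover have "S \<subseteq> C"
  proof -
    have "S \<subseteq> const_base" by (auto simp: S(2) A.gen_def)
    then show ?thesis by (auto simp: C_def F_def)
  qed
  ultimately have sub: "const_base \<subseteq> C" by (auto simp: S(2) A.gen_def)
  have "finite F" using S(1) by (simp add: F_def)
  then obtain i :: int where i: "i \<notin> F" using ex_new_if_finite infinite_UNIV_int by blast
  have "Alg 0 (Poly_Mapping.single i 1) 0 \<in> const_base" by (simp add: const_base_def)
  then show False using sub i by (auto simp: C_def)
qed

section \<open>Finite generation of the whole algebra\<close>

lemma finitely_generated_alg: "finitely_generated_subalgebra A.coded (carrier A.coded)"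
proof -
  let ?T = "\<lambda>i. Alg (Poly_Mapping.single i 1) 0 0"
  let ?M = "\<lambda>m. Alg 0 0 (Poly_Mapping.single m 1)"
  \<comment> \<open>\<open>?T 0\<close> and \<open>?M (0, 0, 0)\<close> are the idempotents that
    separate the two factors; the others are eps, the variables and their inverses.\<close>
  define S where "S = {Alg 0 1 0, ?T 0, ?T 1, ?T (- 1), ?M (0, 0, 0), ?M (1, 0, 0), ?M (- 1, 0, 0),
    ?M (0, 1, 0), ?M (0, - 1, 0), ?M (0, 0, 1), ?M (0, 0, - 1)}"
  have "x \<in> C" if C: "A.subalg C" "S \<subseteq> C" for C x
  proof -
    have mult: "x * y \<in> C" and add: "x + y \<in> C" and scale: "const c * x \<in> C"
      if "x \<in> C" "y \<in> C" for x y c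
      using C(1) that by (auto simp: A.subalg_def)
    have powers: "f i \<in> C" if "f 0 \<in> C" "f 1 \<in> C" "f (- 1) \<in> C" "\<And>i j. f (i + j) = f i * f j"
      for f :: "int \<Rightarrow> alg" and i
    proof (induction i rule: int_induct[of _ 0])
      case (step1 i)
      then show ?case using that by (simp add: mult)
    next
      case (step2 i)
      then have "f i * f (- 1) \<in> C" using that(3) by (intro mult)
      then show ?case using that(4)[of i "- 1"] by simp
    qed (rule that(1))
    have T: "?T i \<in> C" for i
      by (rule powers[of ?T]) (use C(2) in \<open>auto simp: S_def mult_single intro: alg_eqI\<close>)
    have M: "?M (i, j, k) \<in> C" for i j k
    proof -
      have "?M (i, 0, 0) \<in> C" "?M (0, j, 0) \<in> C" "?M (0, 0, k) \<in> C"
        by (rule powers[of "\<lambda>i. ?M (i, 0, 0)"] powers[of "\<lambda>i. ?M (0, i, 0)"]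
              powers[of "\<lambda>i. ?M (0, 0, i)"];
            use C(2) in \<open>auto simp: S_def mult_single intro: alg_eqI\<close>)+
      then have "?M (i, 0, 0) * ?M (0, j, 0) * ?M (0, 0, k) \<in> C" by (intro mult)
      moreover have "?M (i, 0, 0) * ?M (0, j, 0) * ?M (0, 0, k) = ?M (i, j, k)"
        by (rule alg_eqI) (auto simp: mult_single)
      ultimately show ?thesis by simp
    qed
    have zero: "0 \<in> C" using scale[OF T T, of 0] A.inc_zero by simp
    have base: "Alg f 0 0 \<in> C" for f
    proof (induction f rule: poly_mapping_single_induct)
      case (single i c)
      have "Alg (Poly_Mapping.single i c) 0 0 = const c * ?T i"
        by (rule alg_eqI) (auto simp: mult_single)
      then show ?case using scale[OF T T] by simp
    next
      case (add f g)
      have "Alg (f + g) 0 0 = Alg f 0 0 + Alg g 0 0" by (rule alg_eqI) auto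
      then show ?case using add \<open>\<And>y x. x \<in> C \<Longrightarrow> y \<in> C \<Longrightarrow> x + y \<in> C\<close> by simp
    qed (use zero in \<open>simp add: zero_alg_def\<close>)
    have tor: "Alg 0 0 f \<in> C" for f
    proof (induction f rule: poly_mapping_single_induct)
      case (single m c)
      have "Alg 0 0 (Poly_Mapping.single m c) = const c * ?M m"
        by (rule alg_eqI) (auto simp: mult_single)
      moreover have "?M m \<in> C" using M by (cases m) auto
      ultimately show ?case using scale by simp
    next
      case (add f g)
      have "Alg 0 0 (f + g) = Alg 0 0 f + Alg 0 0 g" by (rule alg_eqI) auto
      then show ?case using add \<open>\<And>y x. x \<in> C \<Longrightarrow> y \<in> C \<Longrightarrow> x + y \<in> C\<close> by simp
    qed (use zero in \<open>simp add: zero_alg_def\<close>)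
    have "Alg 0 1 0 \<in> C" using C(2) by (auto simp: S_def)
    then have "Alg (base x) 0 0 + (Alg (nilp x) 0 0 * Alg 0 1 0 + Alg 0 0 (tor x)) \<in> C"
      by (intro add mult base tor)
    moreover have "Alg (base x) 0 0 + (Alg (nilp x) 0 0 * Alg 0 1 0 + Alg 0 0 (tor x)) = x"
      by (rule alg_eqI) auto
    ultimately show "x \<in> C" by simp
  qed
  then have "UNIV = A.gen S" by (auto simp: A.gen_def)
  moreover have "finite S" by (simp add: S_def)
  ultimately show ?thesis using A.finitely_generated_coded_iff[of UNIV] by auto
qed

section \<open>A chain of four prime ideals\<close>

text \<open>This is the kernel of a unital homomorphism into a domain.\<close>

lemma prime_ideal_tor_kernel:
  assumes "\<And>i j. s (i + j) = s i + s j"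
  shows "prime_ideal {x. push s (tor x) = (0 :: int \<times> int \<times> int \<Rightarrow>\<^sub>0 complex)}"
proof -
  have "s 0 = 0" using assms[of 0 0] by simp
  then show ?thesis by (simp add: prime_ideal_def push_add push_mult[of s, OF assms] push_one[of s])
qed

lemma prime_chain_alg:
  obtains P :: "nat \<Rightarrow> alg set"
  where "\<And>i. prime_ideal (P i)" "\<And>i. i < 3 \<Longrightarrow> P i \<subset> P (Suc i)"
proof
  \<comment> \<open>\<open>s n\<close> specialises the first \<open>n\<close> of x, y, z to 1. The
    map for \<open>Suc n\<close> factors through the one for \<open>n\<close>, so the kernels
    increase.\<close>
  define s :: "nat \<Rightarrow> int \<times> int \<times> int \<Rightarrow> int \<times> int \<times> int" where
    "s n = (\<lambda>(i, j, k). (if n \<ge> 1 then 0 else i, if n \<ge> 2 then 0 else j, if n \<ge> 3 then 0 else k))" for n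
  let ?P = "\<lambda>n. {x. push (s n) (tor x) = 0}"
  show "prime_ideal (?P n)" for n
    by (rule prime_ideal_tor_kernel) (auto simp: s_def)
  show "?P n \<subset> ?P (Suc n)" if "n < 3" for n
  proof (rule psubsetI)
    have *: "s (Suc n) \<circ> s n = s (Suc n)" by (auto simp: s_def)
    show "?P n \<subseteq> ?P (Suc n)"
    proof
      fix x assume "x \<in> ?P n"
      then have "push (s (Suc n)) (push (s n) (tor x)) = 0" by simp
      then show "x \<in> ?P (Suc n)" by (simp add: push_comp *)
    qed
    \<comment> \<open>The exponent of the variable specialised by \<open>s (Suc n)\<close> but not
      by \<open>s n\<close>; this variable minus 1 lies only in the larger kernel.\<close>
    define w :: "int \<times> int \<times> int" where
      "w = (if n = 0 then 1 else 0, if n = 1 then 1 else 0, if n = 2 then 1 else 0)"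
    have w: "w \<noteq> 0" "s n w = w" "s n 0 = 0" "s (Suc n) w = 0" "s (Suc n) 0 = 0"
      using that by (auto simp: w_def s_def zero_prod_def)
    let ?x = "Alg 0 0 (Poly_Mapping.single w 1 + Poly_Mapping.single 0 (- 1))"
    have "?x \<in> ?P (Suc n)" by (simp add: push_add w flip: single_one single_add)
    moreover have "?x \<notin> ?P n"
    proof
      assume "?x \<in> ?P n"
      then have "Poly_Mapping.single w (1::complex) + Poly_Mapping.single 0 (- 1) = 0"
        by (simp add: push_add w)
      then have "Poly_Mapping.lookup (Poly_Mapping.single w (1::complex) + Poly_Mapping.single 0 (- 1)) w = 0"
        by simp
      then show False using w(1) by (simp add: lookup_add lookup_single when_def)
    qed
    ultimately show "?P n \<noteq> ?P (Suc n)" by blast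
  qed
qed

section \<open>Krull dimension\<close>

text \<open>Gaussian elimination with unknowns \<open>J\<close> and equations \<open>K\<close>: an
  equation with a nonzero coefficient is solved for one unknown, leaving one fewer of each.\<close>

lemma homogeneous_system_nontrivial:
  fixes f :: "'j \<Rightarrow> 'k \<Rightarrow> 'f::field"
  assumes "finite K" "finite J" "card K < card J"
  shows "\<exists>c. (\<exists>j\<in>J. c j \<noteq> 0) \<and> (\<forall>k\<in>K. (\<Sum>j\<in>J. c j * f j k) = 0)"
  using assms
proof (induction K arbitrary: J f)
  case empty
  then have "J \<noteq> {}" by auto
  then show ?case by (intro exI[of _ "\<lambda>_. 1"]) auto
next
  case (insert k K)
  show ?case
  proof (cases "\<forall>j\<in>J. f j k = 0")
    case True
    have "card K < card J" using insert.prems insert.hyps by simp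
    from insert.IH[OF insert.prems(1) this, of f] True show ?thesis by auto
  next
    case False
    then obtain i where i: "i \<in> J" "f i k \<noteq> 0" by auto
    let ?J = "J - {i}"
    \<comment> \<open>The coefficients after equation \<open>k\<close>, solved for unknown
      \<open>i\<close>, is substituted into equation \<open>l\<close>.\<close>
    define g where "g j l = f j l - f j k / f i k * f i l" for j l
    have "card K < card ?J" using insert.prems insert.hyps i by simp
    with insert.IH[of ?J g] insert.prems(1) obtain c where c: "\<exists>j\<in>?J. c j \<noteq> 0"
      "\<And>l. l \<in> K \<Longrightarrow> (\<Sum>j\<in>?J. c j * g j l) = 0" by auto
    \<comment> \<open>The value \<open>- t\<close> for unknown \<open>i\<close> makes equation
      \<open>k\<close> hold.\<close>
    define t where "t = (\<Sum>j\<in>?J. c j * f j k) / f i k"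
    define c' where "c' = c(i := - t)"
    have sum_c': "(\<Sum>j\<in>J. c' j * f j l) = (\<Sum>j\<in>?J. c j * f j l) - t * f i l" for l
    proof -
      have "(\<Sum>j\<in>J. c' j * f j l) = c' i * f i l + (\<Sum>j\<in>?J. c' j * f j l)"
        using i insert.prems(1) by (simp add: sum.remove)
      also have "(\<Sum>j\<in>?J. c' j * f j l) = (\<Sum>j\<in>?J. c j * f j l)"
        by (rule sum.cong) (auto simp: c'_def)
      finally show ?thesis by (simp add: c'_def)
    qed
    have "(\<Sum>j\<in>J. c' j * f j l) = 0" if "l \<in> insert k K" for l
    proof (cases "l = k")
      case True
      then show ?thesis using i by (simp add: sum_c' t_def)
    next
      case False
      with that have "l \<in> K" by simp
      have "(\<Sum>j\<in>?J. c j * g j l) = (\<Sum>j\<in>?J. c j * f j l) - (\<Sum>j\<in>?J. c j * f j k * (f i l / f i k))"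
        by (simp add: g_def algebra_simps flip: sum_subtractf)
      also have "(\<Sum>j\<in>?J. c j * f j k * (f i l / f i k)) = t * f i l"
        by (simp add: t_def sum_distrib_right sum_divide_distrib)
      finally show ?thesis using c(2)[OF \<open>l \<in> K\<close>] by (simp add: sum_c')
    qed
    moreover have "\<exists>j\<in>J. c' j \<noteq> 0" using c(1) by (auto simp: c'_def)
    ultimately show ?thesis by blast
  qed
qed

section \<open>Algebraic independence along a chain of primes\<close>

text \<open>The lowest power of \<open>a\<close> with a coefficient not in \<open>Q\<close> can be cancelled modulo \<open>P\<close>.\<close>
lemma prime_ideal_coefficients:
  assumes P: "prime_ideal P" and Q: "prime_ideal Q" and PQ: "P \<subseteq> Q" and a: "a \<in> Q" "a \<notin> P"
    and sum: "(\<Sum>i<N. F i * a ^ i) \<in> P"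
    and Z: "\<And>i. i < N \<Longrightarrow> F i \<in> Q \<Longrightarrow> Z i" "\<And>i. i < N \<Longrightarrow> Z i \<Longrightarrow> F i = 0"
    and i: "i < N"
  shows "Z i"
  using i
proof (induction i rule: less_induct)
  case (less i)
  \<comment> \<open>The terms above \<open>i\<close> with \<open>a ^ Suc i\<close> extracted; those
    below \<open>i\<close> vanish by induction. Cancelling \<open>a ^ i\<close> modulo
    \<open>P\<close> leaves \<open>F i + a * ?y\<close>, and \<open>a\<close> lies in
    \<open>Q\<close>.\<close>
  let ?y = "\<Sum>j\<in>{Suc i..<N}. F j * a ^ (j - Suc i)"
  have "(\<Sum>i<N. F i * a ^ i) = (\<Sum>j\<in>{i..<N}. F j * a ^ j)"
  proof (rule sum.mono_neutral_right)
    show "\<forall>j\<in>{..<N} - {i..<N}. F j * a ^ j = 0" using less Z(2) by auto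
  qed auto
  also have "\<dots> = F i * a ^ i + (\<Sum>j\<in>{Suc i..<N}. F j * a ^ j)"
    using less.prems by (simp add: sum.atLeast_Suc_lessThan)
  also have "(\<Sum>j\<in>{Suc i..<N}. F j * a ^ j) = (\<Sum>j\<in>{Suc i..<N}. a ^ i * a * (F j * a ^ (j - Suc i)))"
  proof (rule sum.cong)
    fix j assume "j \<in> {Suc i..<N}"
    then have "a ^ j = a ^ i * a * a ^ (j - Suc i)"
      by (metis atLeastLessThan_iff le_add_diff_inverse mult.commute power_Suc power_add)
    then show "F j * a ^ j = a ^ i * a * (F j * a ^ (j - Suc i))" by (simp add: mult_ac)
  qed simp
  also have "F i * a ^ i + \<dots> = a ^ i * (F i + a * ?y)"
    by (simp add: algebra_simps sum_distrib_left)
  finally have "a ^ i * (F i + a * ?y) \<in> P" using sum by simp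
  moreover have "a ^ i \<notin> P"
    by (induction i) (use P a in \<open>auto simp: prime_ideal_def\<close>)
  ultimately have "F i + a * ?y \<in> Q" using P PQ by (auto simp: prime_ideal_def)
  moreover have "a * (- ?y) \<in> Q" using Q a unfolding prime_ideal_def by blast
  ultimately have "(F i + a * ?y) + a * (- ?y) \<in> Q" using Q unfolding prime_ideal_def by blast
  then show ?case using Z(1) less.prems by simp
qed

lemma (in coded_algebra) prime_ideal_inc:
  assumes "prime_ideal P" "inc c \<in> P"
  shows "c = 0"
proof (rule ccontr)
  assume "c \<noteq> 0"
  then have "inc c * inc (1 / c) = 1" by (simp add: inc_one flip: inc_mult)
  then show False using assms unfolding prime_ideal_def by metis
qed

text \<open>The relation is a polynomial in \<open>a 0\<close> whose coefficients are polynomials in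
  \<open>a 1\<close>, and so on. Each passage to the next prime peels off one variable, until
  constants in \<open>P 4\<close> remain; nonzero constants are units.\<close>

lemma (in coded_algebra) chain_independent:
  fixes c :: "nat \<Rightarrow> nat \<Rightarrow> nat \<Rightarrow> nat \<Rightarrow> complex"
  assumes P: "\<And>i. i \<le> 4 \<Longrightarrow> prime_ideal (P i)" "\<And>i. i < 4 \<Longrightarrow> P i \<subset> P (Suc i)"
    and a: "\<And>i. i < 4 \<Longrightarrow> a i \<in> P (Suc i) - P i"
    and sum: "(\<Sum>i<N. (\<Sum>j<N. (\<Sum>k<N. (\<Sum>l<N. inc (c i j k l) * a 3 ^ l) * a 2 ^ k) * a 1 ^ j) * a 0 ^ i) = 0"
    and less: "i < N" "j < N" "k < N" "l < N"
  shows "c i j k l = 0"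
proof -
  have step: "Z i"
    if "m = Suc n" "n < 4" "(\<Sum>i<N. F i * a n ^ i) \<in> P n"
      "\<And>i. F i \<in> P m \<Longrightarrow> Z i" "\<And>i. Z i \<Longrightarrow> F i = 0" "i < N" for F Z m n i
  proof (rule prime_ideal_coefficients)
    show "prime_ideal (P n)" "prime_ideal (P m)" using P(1) that(1,2) by simp_all
    show "P n \<subseteq> P m" using P(2) that(1,2) by blast
    show "a n \<in> P m" "a n \<notin> P n" using a that(1,2) by blast+
    show "(\<Sum>i<N. F i * a n ^ i) \<in> P n" by fact
  qed (use that(4-6) in blast)+
  let ?S4 = "\<lambda>i j k. \<Sum>l<N. inc (c i j k l) * a 3 ^ l"
  let ?S3 = "\<lambda>i j. \<Sum>k<N. ?S4 i j k * a 2 ^ k"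
  let ?S2 = "\<lambda>i. \<Sum>j<N. ?S3 i j * a 1 ^ j"
  \<comment> \<open>Vanishing of all constants inside a coefficient: it is implied by membership of
    that coefficient in the prime and makes the coefficient equal to 0, as the cancellation
    requires.\<close>
  let ?Z4 = "\<lambda>i j k. \<forall>l<N. c i j k l = 0"
  let ?Z3 = "\<lambda>i j. \<forall>k<N. ?Z4 i j k"
  let ?Z2 = "\<lambda>i. \<forall>j<N. ?Z3 i j"
  have Z4: "?Z4 i j k" if "?S4 i j k \<in> P 3" for i j k
  proof (intro allI impI)
    fix l assume "l < N"
    show "c i j k l = 0"
    proof (rule step[where F = "\<lambda>l. inc (c i j k l)" and Z = "\<lambda>l. c i j k l = 0", OF _ _ that _ _ \<open>l < N\<close>])
      show "c i j k l = 0" if "inc (c i j k l) \<in> P 4" for l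
        by (rule prime_ideal_inc[OF P(1) that]) simp
    qed (simp_all add: inc_zero)
  qed
  have Z3: "?Z3 i j" if "?S3 i j \<in> P 2" for i j
  proof (intro allI impI)
    fix k l assume "k < N" "l < N"
    have "?Z4 i j k"
      by (rule step[where F = "?S4 i j" and Z = "?Z4 i j", OF _ _ that Z4 _ \<open>k < N\<close>]) (simp_all add: inc_zero)
    with \<open>l < N\<close> show "c i j k l = 0" by blast
  qed
  have Z2: "?Z2 i" if "?S2 i \<in> P 1" for i
  proof (intro allI impI)
    fix j k l assume "j < N" "k < N" "l < N"
    have "?Z3 i j"
      by (rule step[where F = "?S3 i" and Z = "?Z3 i", OF _ _ that Z3 _ \<open>j < N\<close>]) (simp_all add: inc_zero)
    with \<open>k < N\<close> \<open>l < N\<close> show "c i j k l = 0" by blast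
  qed
  have start: "(\<Sum>i<N. ?S2 i * a 0 ^ i) \<in> P 0"
    using P(1)[of 0] unfolding sum by (simp add: prime_ideal_def)
  have "?Z2 i"
    by (rule step[where F = ?S2 and Z = ?Z2, OF _ _ start Z2 _ less(1)]) (simp_all add: inc_zero)
  with less show ?thesis by simp
qed

section \<open>Growth of supports\<close>

definition cube :: "nat \<Rightarrow> ((int + int) + int \<times> int \<times> int) set" where
  "cube r = (let I = {- int r..int r} in (I <+> I) <+> (I \<times> I \<times> I))"

lemma finite_cube: "finite (cube r)"
  by (simp add: cube_def Let_def)

lemma card_cube: "card (cube r) \<le> 3 * (2 * r + 1) ^ 3"
proof -
  let ?n = "2 * r + 1"
  have n: "card {- int r..int r} = ?n" by simp
  have "card (cube r) = ?n + ?n + ?n * (?n * ?n)"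
    by (simp only: cube_def Let_def card_Plus card_cartesian_product n finite_Plus finite_cartesian_product
        finite_atLeastAtMost_int)
  also have "\<dots> \<le> ?n ^ 3 + ?n ^ 3 + ?n ^ 3"
    by (intro add_mono) (auto simp: power3_eq_cube)
  finally show ?thesis by simp
qed

definition supported :: "nat \<Rightarrow> alg \<Rightarrow> bool" where
  "supported r x \<longleftrightarrow> (let I = {- int r..int r} in
     Poly_Mapping.keys (base x) \<subseteq> I \<and> Poly_Mapping.keys (nilp x) \<subseteq> I \<and>
     Poly_Mapping.keys (tor x) \<subseteq> I \<times> I \<times> I)"

lemma supported_coef: "supported r x \<Longrightarrow> i \<notin> cube r \<Longrightarrow> coef x i = 0"
  by (auto simp: supported_def cube_def Let_def coef_def in_keys_iff split: sum.splits)

lemma supported_mono: "supported r x \<Longrightarrow> r \<le> s \<Longrightarrow> supported s x"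
  unfolding supported_def Let_def by (force dest: subsetD)

lemma supported_one: "supported 0 1"
  by (auto simp: supported_def zero_prod_def)

text \<open>Exponents add under multiplication, so the supports of monomials in fixed elements grow
  linearly with the degree.\<close>

lemma supported_mult:
  assumes "supported r x" "supported s y"
  shows "supported (r + s) (x * y)"
proof -
  let ?I = "\<lambda>r. {- int r..int r}"
  have *: "Poly_Mapping.keys (f * g) \<subseteq> ?I (r + s)"
    if "Poly_Mapping.keys f \<subseteq> ?I r" "Poly_Mapping.keys g \<subseteq> ?I s" for f g :: laurent and r s
    using keys_mult[of f g] that by fastforce
  have "Poly_Mapping.keys (base x * nilp y) \<subseteq> ?I (r + s)"
    "Poly_Mapping.keys (base y * nilp x) \<subseteq> ?I (r + s)"
    using *[of "base x" r "nilp y" s] *[of "base y" s "nilp x" r] assms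
    by (simp_all add: supported_def Let_def add.commute)
  then have "Poly_Mapping.keys (nilp (x * y)) \<subseteq> ?I (r + s)"
    using keys_add[of "base x * nilp y" "base y * nilp x"] by auto
  moreover have "Poly_Mapping.keys (tor (x * y)) \<subseteq> ?I (r + s) \<times> ?I (r + s) \<times> ?I (r + s)"
    using keys_mult[of "tor x" "tor y"] assms by (fastforce simp: supported_def Let_def)
  ultimately show ?thesis using assms * by (simp add: supported_def Let_def)
qed

lemma supported_power: "supported r x \<Longrightarrow> supported (n * r) (x ^ n)"
  by (induction n) (auto intro: supported_one supported_mult)

lemma supported_exists: "\<exists>r. supported r x"
proof -
  define Y where "Y = Poly_Mapping.keys (base x) \<union> Poly_Mapping.keys (nilp x) \<union>
    (\<Union>(i, j, k)\<in>Poly_Mapping.keys (tor x). {i, j, k})"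
  have "finite Y" by (auto simp: Y_def)
  \<comment> \<open>\<open>nat i + nat (- i)\<close> is the absolute value, and the sum of these
    bounds each one.\<close>
  define r where "r = (\<Sum>i\<in>Y. nat i + nat (- i))"
  have "nat i + nat (- i) \<le> r" if "i \<in> Y" for i
    unfolding r_def using \<open>finite Y\<close> that by (intro member_le_sum) auto
  then have Y: "Y \<subseteq> {- int r..int r}" by fastforce
  have "Poly_Mapping.keys (tor x) \<subseteq> Y \<times> Y \<times> Y" by (force simp: Y_def)
  also have "\<dots> \<subseteq> {- int r..int r} \<times> {- int r..int r} \<times> {- int r..int r}"
    by (intro Sigma_mono Y)
  finally have "supported r x"
    using Y by (simp add: supported_def Let_def Y_def)
  then show ?thesis ..
qed

lemma coef_linear:
  "coef 0 i = 0" "coef (x + y) i = coef x i + coef y i" "coef (const c * x) i = c * coef x i"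
proof -
  have 1: "Poly_Mapping.lookup (Poly_Mapping.single 0 c * f) k = c * Poly_Mapping.lookup f k"
    for f :: "'a::comm_monoid_add \<Rightarrow>\<^sub>0 complex" and k
  proof (induction f rule: poly_mapping_single_induct)
    case (single k c)
    then show ?case by (simp add: mult_single lookup_single when_def)
  qed (auto simp: lookup_add algebra_simps)
  show "coef 0 i = 0" "coef (x + y) i = coef x i + coef y i" "coef (const c * x) i = c * coef x i"
    by (auto simp: coef_def lookup_add 1 split: sum.splits)
qed

lemma coef_sum: "coef (\<Sum>j\<in>J. g j) i = (\<Sum>j\<in>J. coef (g j) i)"
  by (induction J rule: infinite_finite_induct) (auto simp: coef_linear)

section \<open>Dependence of four elements and the dimension\<close>

lemma alg_dependent:
  fixes a :: "nat \<Rightarrow> alg"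
  obtains N c i j k l where
    "(\<Sum>i<N. (\<Sum>j<N. (\<Sum>k<N. (\<Sum>l<N. const (c i j k l) * a 3 ^ l) * a 2 ^ k) * a 1 ^ j) * a 0 ^ i) = 0"
    "i < N" "j < N" "k < N" "l < N" "c i j k l \<noteq> 0"
proof -
  obtain r where r: "\<And>n. supported (r n) (a n)"
    using choice[of "\<lambda>n r. supported r (a n)"] supported_exists by blast
  \<comment> \<open>A common exponent bound for the four elements; \<open>Suc\<close> makes
    \<open>d\<close> and \<open>N\<close> positive, as \<open>8 * N * d + 1 \<le> 9 * N * d\<close>
    requires.\<close>
  define d where "d = Suc (r 0 + r 1 + r 2 + r 3)"
  have a: "supported d (a 0)" "supported d (a 1)" "supported d (a 2)" "supported d (a 3)"
    by (rule supported_mono[OF r], simp add: d_def)+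
  \<comment> \<open>2188 is 3 * 9^3 + 1: the cube of radius \<open>4 * N * d\<close> has at most 3 *
    (9 N d)^3 = 2187 d^3 N^3 indices, fewer than the N^4 monomials.\<close>
  define N where "N = 2188 * d ^ 3"
  have N: "N \<ge> 1" by (simp add: N_def d_def)
  let ?J = "{..<N} \<times> {..<N} \<times> {..<N} \<times> {..<N}"
  define v where "v = (\<lambda>(i, j, k, l). a 3 ^ l * a 2 ^ k * a 1 ^ j * a 0 ^ i)"
  let ?K = "cube (4 * N * d)"
  have supp: "supported (4 * N * d) (v x)" if "x \<in> ?J" for x
  proof -
    obtain i j k l where x: "x = (i, j, k, l)" by (cases x) auto
    have "supported (l * d + k * d + j * d + i * d) (v x)"
      unfolding x v_def prod.case by (intro supported_mult supported_power a)
    moreover have "l * d + k * d + j * d + i * d \<le> N * d + N * d + N * d + N * d"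
      using that by (intro add_mono mult_right_mono) (auto simp: x)
    ultimately show ?thesis by (auto intro: supported_mono)
  qed
  have "8 * N * d + 1 \<le> 9 * N * d" using N by (simp add: d_def)
  then have "(8 * N * d + 1) ^ 3 \<le> (9 * N * d) ^ 3" by (rule power_mono) simp
  then have "3 * (8 * N * d + 1) ^ 3 \<le> 2187 * d ^ 3 * N ^ 3"
    by (simp add: power_mult_distrib mult_ac)
  also have "\<dots> < N * N ^ 3" using N by (simp add: N_def d_def)
  finally have "3 * (8 * N * d + 1) ^ 3 < N * N ^ 3" .
  then have "card ?K < card ?J"
    using card_cube[of "4 * N * d"] by (simp add: card_cartesian_product power3_eq_cube)
  from homogeneous_system_nontrivial[OF finite_cube _ this, of "\<lambda>x. coef (v x)"]
  have "\<exists>c. (\<exists>x\<in>?J. c x \<noteq> 0) \<and> (\<forall>m\<in>?K. (\<Sum>x\<in>?J. c x * coef (v x) m) = 0)"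
    by (simp only: finite_cartesian_product finite_lessThan simp_thms)
  then obtain c where c: "\<exists>x\<in>?J. c x \<noteq> 0" "\<And>m. m \<in> ?K \<Longrightarrow> (\<Sum>x\<in>?J. c x * coef (v x) m) = 0"
    by blast
  have "(\<Sum>x\<in>?J. const (c x) * v x) = 0"
  proof (rule coef_inject, rule ext)
    fix m
    have "(\<Sum>x\<in>?J. c x * coef (v x) m) = 0"
    proof (cases "m \<in> ?K")
      case False
      then show ?thesis using supported_coef[OF supp] by (intro sum.neutral) auto
    qed (rule c(2))
    then show "coef (\<Sum>x\<in>?J. const (c x) * v x) m = coef 0 m"
      by (simp add: coef_sum coef_linear)
  qed
  moreover have "(\<Sum>x\<in>?J. const (c x) * v x)
    = (\<Sum>i<N. \<Sum>j<N. \<Sum>k<N. \<Sum>l<N. const (c (i, j, k, l)) * v (i, j, k, l))"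
    by (simp add: sum.cartesian_product case_prod_beta)
  ultimately have "(\<Sum>i<N. (\<Sum>j<N. (\<Sum>k<N. (\<Sum>l<N. const (c (i, j, k, l)) * a 3 ^ l) * a 2 ^ k) * a 1 ^ j) * a 0 ^ i) = 0"
    by (simp add: v_def sum_distrib_right mult.assoc)
  moreover from c(1) obtain i j k l where "i < N" "j < N" "k < N" "l < N" "c (i, j, k, l) \<noteq> 0"
    by auto
  ultimately show thesis by (rule that[where c = "\<lambda>i j k l. c (i, j, k, l)"])
qed

lemma krull_dim_alg: "krull_dim A.coded = 3"
proof -
  obtain P :: "nat \<Rightarrow> alg set"
    where P: "\<And>i. prime_ideal (P i)" "\<And>i. i < 3 \<Longrightarrow> P i \<subset> P (Suc i)"
    using prime_chain_alg by blast
  have "krull_dim A.coded = enat 3"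
  proof (rule A.krull_dim_coded[where P = P])
    show "prime_ideal (P i)" for i by (rule P)
    show "P i \<subset> P (Suc i)" if "i < 3" for i using that by (rule P)
    fix m and Q :: "nat \<Rightarrow> alg set"
    assume Q: "\<And>i. i \<le> m \<Longrightarrow> prime_ideal (Q i)" "\<And>i. i < m \<Longrightarrow> Q i \<subset> Q (Suc i)"
    show "m \<le> 3"
    proof (rule ccontr)
      assume m: "\<not> m \<le> 3"
      \<comment> \<open>A longer chain begins with five primes; \<open>a i\<close> witnesses the
        strictness of one of its inclusions.\<close>
      define a where "a i = (SOME x. x \<in> Q (Suc i) - Q i)" for i
      have a: "a i \<in> Q (Suc i) - Q i" if "i < 4" for i
      proof -
        have "Q i \<subset> Q (Suc i)" using Q(2) m that by simp
        then have "\<exists>x. x \<in> Q (Suc i) - Q i" by blast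
        then show ?thesis unfolding a_def by (rule someI_ex)
      qed
      obtain N c i j k l where *:
        "(\<Sum>i<N. (\<Sum>j<N. (\<Sum>k<N. (\<Sum>l<N. const (c i j k l) * a 3 ^ l) * a 2 ^ k) * a 1 ^ j) * a 0 ^ i) = 0"
        "i < N" "j < N" "k < N" "l < N" "c i j k l \<noteq> 0"
        by (rule alg_dependent[of a])
      have "c i j k l = 0"
      proof (rule A.chain_independent[OF _ _ a *(1-5)])
        show "prime_ideal (Q i)" if "i \<le> 4" for i using Q(1) m that by simp
        show "Q i \<subset> Q (Suc i)" if "i < 4" for i using Q(2) m that by simp
      qed
      with *(6) show False by simp
    qed
  qed
  then show ?thesis by (simp add: numeral_eq_enat)
qed

theorem mainTheorem1:
  shows "\<exists>A :: complex_algebra.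
    algebra complex_field A \<and>
    finitely_generated_subalgebra A (carrier A) \<and>
    krull_dim A = 3 \<and>
    \<not> finitely_generated_subalgebra A (derksen_invariant A) \<and>
    \<not> finitely_generated_subalgebra A (makar_limanov_invariant A) \<and>
    derksen_invariant A = makar_limanov_invariant A"
  using A.algebra_coded finitely_generated_alg krull_dim_alg not_finitely_generated_const_base
  by (intro exI[of _ A.coded]) (simp add: invariants_alg)

end
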